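(* The set $Z_{60}\subset\mathbb{P}^3$ has the geproci property. More precisely, its general projection to $\mathbb{P}^2$ is a complete intersection of curves of degree $6$ and $10$.
   Context: We work over $\mathbb{C}$. The Klein configuration $Z_{60}\subset\mathbb{P}^3=\mathbb{P}^3_{\mathbb{C}}$ (homogeneous coordinates $[x:y:z:w]$) is the following set of $60$ points: the $4$ coordinate points $[1:0:0:0],[0:1:0:0],[0:0:1:0],[0:0:0:1]$; the $24$ points having exactly two nonzero coordinates, the first nonzero coordinate being $1$ and the other one lying in $\{1,i,-1,-i\}$; and the $32$ points $[1:\pm1:\pm1:\pm1]$, $[1:\pm1:\pm i:\pm i]$, $[1:\pm i:\pm1:\pm i]$, $[1:\pm i:\pm i:\pm1]$ (all signs chosen independently). A finite set $Z\subset\mathbb{P}^3$ has the general projection complete intersection property (geproci, for short) if its projection from a general point $P\in\mathbb{P}^3$ to $\mathbb{P}^2$ is a complete intersection, i.e. the image of $Z$, as a reduced zero-dimensional scheme, is the scheme-theoretic intersection of two plane curves. "General" means: $P$ lies in some nonempty Zariski open subset of $\mathbb{P}^3$. *)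

theory Defs
  imports "HOL-Analysis.Analysis" "HOL-Library.Poly_Mapping"
begin

type_synonym 'n monom = "'n \<Rightarrow>\<^sub>0 nat"
type_synonym 'n mpoly = "'n monom \<Rightarrow>\<^sub>0 complex"

definition monom_degree :: "'n::finite monom \<Rightarrow> nat" where
  "monom_degree m = (\<Sum>i\<in>UNIV. Poly_Mapping.lookup m i)"

definition eval_poly :: "'n::finite mpoly \<Rightarrow> complex ^ 'n \<Rightarrow> complex" where
  "eval_poly f v = (\<Sum>m\<in>Poly_Mapping.keys f. Poly_Mapping.lookup f m * (\<Prod>i\<in>UNIV. (v $ i) ^ Poly_Mapping.lookup m i))"

definition homogeneous :: "nat \<Rightarrow> 'n::finite mpoly \<Rightarrow> bool" where
  "homogeneous d f \<longleftrightarrow> (\<forall>m\<in>Poly_Mapping.keys f. monom_degree m = d)"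

text \<open>A point is a line through the origin, i.e. a one-dimensional complex subspace. Note that
  \<open>vec.span\<close> is the span over the field of scalars, here \<open>complex\<close>, while plain \<open>span\<close> would be
  the real span.\<close>

type_synonym 'n point = "(complex ^ 'n) set"

definition proj_space :: "'n::finite point set" where
  "proj_space = {vec.span {v} | v. v \<noteq> 0}"

definition vanishes_at :: "'n::finite mpoly \<Rightarrow> 'n point \<Rightarrow> bool" where
  "vanishes_at f P \<longleftrightarrow> (\<forall>v\<in>P. eval_poly f v = 0)"

definition zariski_closed :: "'n::finite point set \<Rightarrow> bool" where
  "zariski_closed C \<longleftrightarrow>
     (\<exists>S. (\<forall>f\<in>S. \<exists>d. homogeneous d f) \<and> C = {P \<in> proj_space. \<forall>f\<in>S. vanishes_at f P})"

definition zariski_open :: "'n::finite point set \<Rightarrow> bool" where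
  "zariski_open U \<longleftrightarrow> U \<subseteq> proj_space \<and> zariski_closed (proj_space - U)"

definition for_general_point :: "('n::finite point \<Rightarrow> bool) \<Rightarrow> bool" where
  "for_general_point Q \<longleftrightarrow> (\<exists>U. zariski_open U \<and> U \<noteq> {} \<and> (\<forall>P\<in>U. Q P))"

text \<open>The homogeneous ideal of a set of points. Since the field is infinite, a polynomial vanishes
  on every representative of a point iff all its homogeneous components vanish at that point.\<close>

definition vanishing_ideal :: "'n::finite point set \<Rightarrow> 'n mpoly set" where
  "vanishing_ideal X = {f. \<forall>P\<in>X. vanishes_at f P}"

definition ideal_gen2 :: "'n::finite mpoly \<Rightarrow> 'n mpoly \<Rightarrow> 'n mpoly set" where
  "ideal_gen2 F G = {A * F + B * G | A B. True}"

text \<open>Saturation with respect to the irrelevant ideal, whose powers are generated by the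
  homogeneous polynomials of the corresponding degree. Closed subschemes of projective space
  correspond to saturated homogeneous ideals.\<close>

definition saturation :: "'n::finite mpoly set \<Rightarrow> 'n mpoly set" where
  "saturation J = {f. \<exists>N. \<forall>h. homogeneous N h \<longrightarrow> h * f \<in> J}"

definition plane_curve :: "nat \<Rightarrow> 3 mpoly \<Rightarrow> bool" where
  "plane_curve d F \<longleftrightarrow> 0 < d \<and> F \<noteq> 0 \<and> homogeneous d F"

text \<open>The reduced subscheme supported on \<open>X\<close> equals the scheme-theoretic intersection of two
  curves of degrees \<open>a\<close> and \<open>b\<close>: both subschemes have the same saturated ideal.\<close>

definition complete_intersection :: "nat \<Rightarrow> nat \<Rightarrow> 3 point set \<Rightarrow> bool" where
  "complete_intersection a b X \<longleftrightarrow>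
     (\<exists>F G. plane_curve a F \<and> plane_curve b G \<and> saturation (ideal_gen2 F G) = vanishing_ideal X)"

text \<open>The projection from \<open>P\<close> is induced by a linear map \<open>complex ^ 4 \<rightarrow> complex ^ 3\<close> with kernel
  \<open>P\<close> (hence surjective). It is unique up to a linear automorphism of the target, and is defined
  away from \<open>P\<close>.\<close>

definition projection_from :: "4 point \<Rightarrow> complex ^ 4 ^ 3 \<Rightarrow> bool" where
  "projection_from P A \<longleftrightarrow> {v. A *v v = 0} = P"

definition proj_image :: "complex ^ 4 ^ 3 \<Rightarrow> 4 point set \<Rightarrow> 3 point set" where
  "proj_image A Z = (\<lambda>Q. (*v) A ` Q) ` Z"

definition geproci :: "4 point set \<Rightarrow> bool" where
  "geproci Z \<longleftrightarrow> finite Z \<and> Z \<subseteq> proj_space \<and>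
     for_general_point (\<lambda>P. P \<notin> Z \<and>
       (\<forall>A. projection_from P A \<longrightarrow> (\<exists>a b. complete_intersection a b (proj_image A Z))))"

definition pt :: "complex \<Rightarrow> complex \<Rightarrow> complex \<Rightarrow> complex \<Rightarrow> 4 point" where
  "pt x y z w = vec.span {vector [x, y, z, w]}"

definition klein_configuration :: "4 point set" where
  "klein_configuration =
     {pt 1 0 0 0, pt 0 1 0 0, pt 0 0 1 0, pt 0 0 0 1} \<union>
     (\<Union>u\<in>{1, \<i>, -1, -\<i>}. {pt 1 u 0 0, pt 1 0 u 0, pt 1 0 0 u, pt 0 1 u 0, pt 0 1 0 u, pt 0 0 1 u}) \<union>
     (\<Union>a\<in>{1, -1}. \<Union>b\<in>{1, -1}. \<Union>c\<in>{1, -1}.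
        {pt 1 a b c, pt 1 a (b * \<i>) (c * \<i>), pt 1 (a * \<i>) b (c * \<i>), pt 1 (a * \<i>) (b * \<i>) c})"

end

theory Submission
  imports Defs
begin

text \<open>Let \<open>x\<^sub>0, \<dots>, x\<^sub>5\<close> be the Klein coordinates of the line joining the centre \<open>p\<close> to a point
  \<open>v\<close>; they are linear in \<open>v\<close> and satisfy \<open>\<Sum> x\<^sub>n\<^sup>2 = 0\<close>. For each configuration point \<open>v\<close> the indices
  split into three pairs with \<open>x\<^sub>a\<^sup>2 + x\<^sub>b\<^sup>2 = 0\<close>. Hence the sextic cone \<open>F = \<Sum> x\<^sub>n\<^sup>6\<close> with vertex \<open>p\<close> and the
  product \<open>G\<close> of the ten forms \<open>x\<^sub>0 \<mp> \<i> x\<^sub>j\<close>, \<open>1 \<le> j \<le> 5\<close>, vanish on the configuration. The factors of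
  \<open>G\<close> correspond to ten skew lines with six points of the configuration on each, and modulo such
  a factor \<open>F\<close> becomes \<open>- 3 (x\<^sub>a\<^sup>2 + x\<^sub>b\<^sup>2) (x\<^sub>a\<^sup>2 + x\<^sub>c\<^sup>2) (x\<^sub>b\<^sup>2 + x\<^sub>c\<^sup>2)\<close>, which cuts out precisely these six
  points. Peeling off the ten lines one at a time shows that every polynomial vanishing on the
  projected points lies in the ideal generated by \<open>F\<close> and \<open>G\<close>.\<close>

section \<open>Polynomials and linear forms\<close>

lemma eval_poly_superset:
  assumes "finite S" "Poly_Mapping.keys f \<subseteq> S"
  shows "eval_poly f v = (\<Sum>m\<in>S. Poly_Mapping.lookup f m * (\<Prod>i\<in>UNIV. (v $ i) ^ Poly_Mapping.lookup m i))"
  unfolding eval_poly_def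
  by (rule sum.mono_neutral_left) (use assms in \<open>auto simp: in_keys_iff\<close>)

lemma eval_poly_zero [simp]: "eval_poly 0 v = 0"
  by (simp add: eval_poly_def)

lemma eval_poly_add [simp]: "eval_poly (f + g) v = eval_poly f v + eval_poly g v"
proof -
  let ?S = "Poly_Mapping.keys f \<union> Poly_Mapping.keys g"
  have "Poly_Mapping.keys (f + g) \<subseteq> ?S"
    by (rule Poly_Mapping.keys_add)
  then show ?thesis
    by (simp add: eval_poly_superset[of ?S] lookup_add distrib_right sum.distrib)
qed

lemma eval_poly_sum [simp]: "eval_poly (sum f I) v = (\<Sum>i\<in>I. eval_poly (f i) v)"
  by (induction I rule: infinite_finite_induct) auto

lemma eval_poly_single:
  "eval_poly (Poly_Mapping.single m c) v = c * (\<Prod>i\<in>UNIV. (v $ i) ^ Poly_Mapping.lookup m i)"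
  by (simp add: eval_poly_superset[of "{m}"])

lemma poly_mapping_eq_sum_single:
  "f = (\<Sum>m\<in>Poly_Mapping.keys f. Poly_Mapping.single m (Poly_Mapping.lookup f m))"
proof (rule poly_mapping_eqI)
  fix k
  show "Poly_Mapping.lookup f k = Poly_Mapping.lookup
     (\<Sum>m\<in>Poly_Mapping.keys f. Poly_Mapping.single m (Poly_Mapping.lookup f m)) k"
    by (simp add: lookup_sum lookup_single when_def in_keys_iff)
qed

lemma eval_poly_mult [simp]:
  fixes f g :: "'n::finite mpoly"
  shows "eval_poly (f * g) v = eval_poly f v * eval_poly g v"
proof -
  have single: "eval_poly (Poly_Mapping.single m c * Poly_Mapping.single m' c') v =
      eval_poly (Poly_Mapping.single m c) v * eval_poly (Poly_Mapping.single m' c') v"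
    for m m' :: "'n monom" and c c'
    by (simp add: eval_poly_single mult_single lookup_add power_add prod.distrib)
  have "eval_poly ((\<Sum>m\<in>S. Poly_Mapping.single m (a m)) * (\<Sum>m\<in>T. Poly_Mapping.single m (b m))) v =
      eval_poly (\<Sum>m\<in>S. Poly_Mapping.single m (a m)) v *
      eval_poly (\<Sum>m\<in>T. Poly_Mapping.single m (b m)) v"
    for S T and a b :: "'n monom \<Rightarrow> complex"
    by (simp add: sum_distrib_left sum_distrib_right single)
  from this[of "Poly_Mapping.lookup f" "Poly_Mapping.keys f" "Poly_Mapping.lookup g" "Poly_Mapping.keys g"]
  show ?thesis
    by (simp only: flip: poly_mapping_eq_sum_single)
qed

definition Const :: "complex \<Rightarrow> 'n::finite mpoly" where
  "Const c = Poly_Mapping.single 0 c"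

lemma eval_poly_Const [simp]: "eval_poly (Const c) v = c"
  by (simp add: Const_def eval_poly_single)

lemma Const_0 [simp]: "Const 0 = 0" and Const_1 [simp]: "Const 1 = 1"
  by (simp_all add: Const_def)

lemma Const_add: "Const (a + b) = Const a + Const b"
  and Const_mult: "Const (a * b) = Const a * Const b"
  and Const_uminus: "Const (- a) = - Const a"
  by (simp_all add: Const_def single_add mult_single single_uminus)

lemma Const_numeral: "Const (numeral k) = numeral k"
  by (simp add: Const_def)

lemma Const_power: "Const (a ^ k) = Const a ^ k"
  by (induction k) (auto simp: Const_mult)

lemma Const_sum: "Const (sum f I) = (\<Sum>i\<in>I. Const (f i))"
  by (induction I rule: infinite_finite_induct) (auto simp: Const_add)

lemma Const_prod: "Const (prod f I) = (\<Prod>i\<in>I. Const (f i))"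
  by (induction I rule: infinite_finite_induct) (auto simp: Const_mult)

lemma eval_poly_one [simp]: "eval_poly 1 v = 1"
  by (metis Const_1 eval_poly_Const)

lemma eval_poly_power [simp]: "eval_poly (f ^ k) v = eval_poly f v ^ k"
  by (induction k) auto

lemma eval_poly_prod [simp]: "eval_poly (prod f I) v = (\<Prod>i\<in>I. eval_poly (f i) v)"
  by (induction I rule: infinite_finite_induct) auto

definition Var :: "'n::finite \<Rightarrow> 'n mpoly" where
  "Var i = Poly_Mapping.single (Poly_Mapping.single i 1) 1"

lemma Var_power: "Var i ^ k = Poly_Mapping.single (Poly_Mapping.single i k) 1"
  by (induction k) (auto simp: Var_def mult_single single_add[symmetric])

lemma single_eq_Const_prod_Var:
  fixes m :: "'n::finite monom"
  shows "Poly_Mapping.single m c = Const c * (\<Prod>i\<in>UNIV. Var i ^ Poly_Mapping.lookup m i)"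
proof -
  have prod: "(\<Prod>i\<in>S. Poly_Mapping.single (g i) (1::complex)) = Poly_Mapping.single (sum g S) 1"
    for g :: "'n \<Rightarrow> 'n monom" and S
    by (induction S rule: infinite_finite_induct) (auto simp: mult_single)
  have "(\<Sum>i\<in>UNIV. Poly_Mapping.single i (Poly_Mapping.lookup m i)) = m"
    by (rule poly_mapping_eqI) (simp add: lookup_sum lookup_single when_def)
  then show ?thesis
    by (simp add: Var_power prod Const_def mult_single)
qed

section \<open>Homogeneous polynomials\<close>

lemma monom_degree_add: "monom_degree (m + m') = monom_degree m + monom_degree m'"
  by (simp add: monom_degree_def lookup_add sum.distrib)

lemma homogeneous_Const [simp]: "homogeneous 0 (Const c)"
  by (auto simp: homogeneous_def Const_def monom_degree_def split: if_splits)

lemma homogeneous_one [simp]: "homogeneous 0 1"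
  using homogeneous_Const[of 1] by simp

lemma homogeneous_Var [simp]: "homogeneous 1 (Var i)"
  by (auto simp: homogeneous_def Var_def monom_degree_def lookup_single when_def)

lemma homogeneous_zero [simp]: "homogeneous d 0"
  by (simp add: homogeneous_def)

lemma homogeneous_add: "homogeneous d f \<Longrightarrow> homogeneous d g \<Longrightarrow> homogeneous d (f + g)"
  using Poly_Mapping.keys_add[of f g] by (auto simp: homogeneous_def)

lemma homogeneous_sum: "(\<And>i. i \<in> I \<Longrightarrow> homogeneous d (f i)) \<Longrightarrow> homogeneous d (sum f I)"
  by (induction I rule: infinite_finite_induct) (auto intro: homogeneous_add)

lemma homogeneous_mult:
  "homogeneous d f \<Longrightarrow> homogeneous e g \<Longrightarrow> homogeneous (d + e) (f * g)"
  using keys_mult[of f g] by (fastforce simp: homogeneous_def monom_degree_add)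

lemma homogeneous_power: "homogeneous d f \<Longrightarrow> homogeneous (k * d) (f ^ k)"
  by (induction k) (auto intro: homogeneous_mult)

lemma homogeneous_prod:
  "(\<And>i. i \<in> I \<Longrightarrow> homogeneous (d i) (f i)) \<Longrightarrow> homogeneous (sum d I) (prod f I)"
  by (induction I rule: infinite_finite_induct) (auto intro: homogeneous_mult)

lemma homogeneous_Const_mult: "homogeneous d f \<Longrightarrow> homogeneous d (Const c * f)"
  using homogeneous_mult[OF homogeneous_Const] by fastforce

text \<open>The bilinear dot product; \<open>inner\<close> is the real inner product.\<close>

definition dot :: "complex ^ 'n::finite \<Rightarrow> complex ^ 'n \<Rightarrow> complex" where
  "dot u v = (\<Sum>i\<in>UNIV. u $ i * v $ i)"

lemma dot_simps [simp]:
  "dot (u + u') v = dot u v + dot u' v" "dot u (v + v') = dot u v + dot u v'"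
  "dot (u - u') v = dot u v - dot u' v" "dot u (v - v') = dot u v - dot u v'"
  "dot (c *s u) v = c * dot u v" "dot u (c *s v) = c * dot u v"
  "dot 0 v = 0" "dot u 0 = 0" "dot (- u) v = - dot u v"
  by (simp_all add: dot_def algebra_simps sum.distrib sum_subtractf sum_distrib_left sum_negf)

lemma dot_commute: "dot u v = dot v u"
  by (simp add: dot_def mult.commute)

lemma dot_vector_matrix_mult: "dot (c v* B) y = dot c (B *v y)"
  unfolding dot_def vector_matrix_mult_def matrix_vector_mult_def
  by (simp add: sum_distrib_left sum_distrib_right mult_ac) (rule sum.swap)

lemma dot_axis [simp]: "dot u (axis i c) = u $ i * c"
  by (simp add: dot_def axis_def if_distrib cong: if_cong)

lemma dot_left_eqI: "(\<And>y. dot u y = dot v y) \<Longrightarrow> u = v"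
  by (metis dot_axis mult.right_neutral vec_eq_iff)

section \<open>Linear forms as polynomials\<close>

definition lin :: "complex ^ 'n::finite \<Rightarrow> 'n mpoly" where
  "lin c = (\<Sum>i\<in>UNIV. Const (c $ i) * Var i)"

lemma eval_poly_Var [simp]: "eval_poly (Var i) v = v $ i"
proof -
  have "(v $ j) ^ Poly_Mapping.lookup (Poly_Mapping.single i 1) j = (if j = i then v $ i else 1)" for j
    by (simp add: lookup_single when_def)
  then show ?thesis
    by (simp add: Var_def eval_poly_single)
qed

lemma eval_poly_lin [simp]: "eval_poly (lin c) v = dot c v"
  by (simp add: lin_def dot_def)

lemma homogeneous_lin [simp]: "homogeneous 1 (lin c)"
  unfolding lin_def by (intro homogeneous_sum homogeneous_Const_mult homogeneous_Var)

lemma lin_add: "lin (u + v) = lin u + lin v"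
  and lin_scale: "lin (a *s u) = Const a * lin u"
  by (simp_all add: lin_def Const_add Const_mult algebra_simps sum.distrib sum_distrib_left)

lemma lin_uminus: "lin (- u) = - lin u"
  by (simp add: lin_def Const_uminus sum_negf)

lemma lin_diff: "lin (u - v) = lin u - lin v"
  using lin_add[of u "- v"] by (simp add: lin_uminus)

lemma lin_axis: "lin (axis i 1) = Var i"
proof -
  have "lin (axis i 1) = (\<Sum>j\<in>UNIV. if j = i then Var i else 0)"
    unfolding lin_def by (intro sum.cong) (auto simp: axis_def)
  then show ?thesis by simp
qed

text \<open>Monomials of degree \<open>d\<close> contribute to the coefficient of \<open>t^d\<close>
  only, so the restriction to a line through the origin separates the homogeneous
  components.\<close>

lemma eval_poly_on_line:
  fixes f :: "'n::finite mpoly"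
  shows "eval_poly f (t *s v) = poly (\<Sum>m\<in>Poly_Mapping.keys f.
    Polynomial.monom (Poly_Mapping.lookup f m * (\<Prod>i\<in>UNIV. (v $ i) ^ Poly_Mapping.lookup m i))
      (monom_degree m)) t"
  by (simp add: eval_poly_def poly_sum poly_monom power_mult_distrib prod.distrib
      monom_degree_def power_sum mult_ac)

text \<open>The restriction is a univariate polynomial with infinitely many zeros. This fills in the
  origin, where arguments that cancel a nonvanishing form break down.\<close>

lemma eval_poly_line_eq_0:
  assumes "\<And>t. t \<noteq> 0 \<Longrightarrow> eval_poly f (t *s v) = 0"
  shows "eval_poly f (t *s v) = 0"
proof -
  let ?b = "\<Sum>m\<in>Poly_Mapping.keys f.
    Polynomial.monom (Poly_Mapping.lookup f m * (\<Prod>i\<in>UNIV. (v $ i) ^ Poly_Mapping.lookup m i))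
      (monom_degree m)"
  have "UNIV - {0} \<subseteq> {t. poly ?b t = 0}"
    using assms by (auto simp: eval_poly_on_line)
  moreover have "infinite (UNIV - {0::complex})"
    by (simp add: infinite_UNIV_char_0)
  ultimately have "?b = 0"
    using poly_roots_finite finite_subset by blast
  then show ?thesis
    by (simp add: eval_poly_on_line)
qed

section \<open>Ideals generated by two polynomials\<close>

lemma ideal_gen2_add: "f \<in> ideal_gen2 F G \<Longrightarrow> g \<in> ideal_gen2 F G \<Longrightarrow> f + g \<in> ideal_gen2 F G"
  unfolding ideal_gen2_def by clarsimp (metis (no_types, lifting) add.assoc add.left_commute distrib_right)

lemma ideal_gen2_mult: "f \<in> ideal_gen2 F G \<Longrightarrow> h * f \<in> ideal_gen2 F G"
  unfolding ideal_gen2_def by clarsimp (metis (no_types, lifting) distrib_left mult.assoc)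

lemma ideal_gen2_zero [simp]: "0 \<in> ideal_gen2 F G"
  unfolding ideal_gen2_def by (simp add: exI[of _ 0])

lemma ideal_gen2_sum:
  "(\<And>i. i \<in> I \<Longrightarrow> f i \<in> ideal_gen2 F G) \<Longrightarrow> sum f I \<in> ideal_gen2 F G"
  by (induction I rule: infinite_finite_induct) (auto intro: ideal_gen2_add)

lemma ideal_gen2_cong_mult:
  assumes "a - a' \<in> ideal_gen2 F G" "b - b' \<in> ideal_gen2 F G"
  shows "a * b - a' * b' \<in> ideal_gen2 F G"
proof -
  have "a * b - a' * b' = a * (b - b') + b' * (a - a')"
    by (simp add: algebra_simps)
  then show ?thesis
    using assms by (simp add: ideal_gen2_add ideal_gen2_mult)
qed

lemma ideal_gen2_cong_prod:
  "(\<And>i. i \<in> I \<Longrightarrow> f i - g i \<in> ideal_gen2 F G) \<Longrightarrow> prod f I - prod g I \<in> ideal_gen2 F G"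
  by (induction I rule: infinite_finite_induct) (auto intro: ideal_gen2_cong_mult)

lemma ideal_gen2_cong_power:
  "a - a' \<in> ideal_gen2 F G \<Longrightarrow> a ^ k - a' ^ k \<in> ideal_gen2 F G"
  by (induction k) (auto intro: ideal_gen2_cong_mult)

text \<open>Modulo \<open>L\<close> and \<open>M\<close> every variable is a multiple of one linear form \<open>N\<close> that is
  nonzero at \<open>v\<close>, so every polynomial is congruent to a polynomial in \<open>N\<close>, whose coefficients are
  those of the restriction to the line spanned by \<open>v\<close>.\<close>

lemma mem_ideal_gen2_lin:
  fixes l m v \<alpha> \<beta> :: "complex ^ 'n::finite"
  assumes v: "v \<noteq> 0"
    and decomp: "\<And>y. \<exists>c. y = c *s v + dot l y *s \<alpha> + dot m y *s \<beta>"
    and van: "\<And>t. eval_poly f (t *s v) = 0"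
  shows "f \<in> ideal_gen2 (lin l) (lin m)"
proof -
  let ?I = "ideal_gen2 (lin l) (lin m)"
  obtain i where i: "v $ i \<noteq> 0"
    using v by (auto simp: vec_eq_iff)
  \<comment> \<open>\<open>n\<close> is the functional reading off the coefficient of
    \<open>v\<close>: the \<open>i\<close>-th coordinate of the decomposition is solved for
    \<open>c\<close>.\<close>
  define n where "n = (1 / v $ i) *s (axis i 1 - \<alpha> $ i *s l - \<beta> $ i *s m)"
  have n: "y = dot n y *s v + dot l y *s \<alpha> + dot m y *s \<beta>" for y
  proof -
    obtain c where c: "y = c *s v + dot l y *s \<alpha> + dot m y *s \<beta>"
      using decomp by blast
    have "y $ i = c * v $ i + dot l y * \<alpha> $ i + dot m y * \<beta> $ i"
      by (subst c) simp
    moreover have "dot n y = (y $ i - \<alpha> $ i * dot l y - \<beta> $ i * dot m y) / v $ i"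
      unfolding n_def by (simp add: dot_commute[of "axis i 1"] diff_divide_distrib)
    ultimately have "dot n y = c"
      using i by (simp add: field_simps)
    then show ?thesis
      using c by simp
  qed
  have Var: "Var j - Const (v $ j) * lin n \<in> ?I" for j
  proof -
    have "axis j 1 = v $ j *s n + \<alpha> $ j *s l + \<beta> $ j *s m"
    proof (rule dot_left_eqI)
      fix y
      have "y $ j = (dot n y *s v + dot l y *s \<alpha> + dot m y *s \<beta>) $ j"
        using n[of y] by simp
      then show "dot (axis j 1) y = dot (v $ j *s n + \<alpha> $ j *s l + \<beta> $ j *s m) y"
        by (simp add: dot_commute[of "axis j 1"] mult.commute)
    qed
    then have "Var j = Const (v $ j) * lin n + Const (\<alpha> $ j) * lin l + Const (\<beta> $ j) * lin m"
      by (metis lin_axis lin_add lin_scale)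
    then have "Var j - Const (v $ j) * lin n = Const (\<alpha> $ j) * lin l + Const (\<beta> $ j) * lin m"
      by simp
    then show ?thesis
      unfolding ideal_gen2_def by blast
  qed
  define c where "c = (\<lambda>k. Poly_Mapping.lookup f k * (\<Prod>j\<in>UNIV. (v $ j) ^ Poly_Mapping.lookup k j))"
  have single: "Poly_Mapping.single k (Poly_Mapping.lookup f k) -
      Const (c k) * lin n ^ monom_degree k \<in> ?I" for k
  proof -
    have "(\<Prod>j\<in>UNIV. Var j ^ Poly_Mapping.lookup k j) -
        (\<Prod>j\<in>UNIV. (Const (v $ j) * lin n) ^ Poly_Mapping.lookup k j) \<in> ?I"
      by (intro ideal_gen2_cong_prod ideal_gen2_cong_power Var)
    then have "Const (Poly_Mapping.lookup f k) * ((\<Prod>j\<in>UNIV. Var j ^ Poly_Mapping.lookup k j) -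
        (\<Prod>j\<in>UNIV. (Const (v $ j) * lin n) ^ Poly_Mapping.lookup k j)) \<in> ?I"
      by (rule ideal_gen2_mult)
    then show ?thesis
      by (simp add: single_eq_Const_prod_Var[of k] c_def right_diff_distrib power_mult_distrib
          prod.distrib monom_degree_def power_sum Const_mult Const_prod Const_power mult.assoc)
  qed
  let ?K = "Poly_Mapping.keys f"
  \<comment> \<open>Vanishing on the line makes the \<open>c k\<close> of each degree sum to zero;
    these sums are the coefficients of the powers of \<open>lin n\<close> below.\<close>
  have "(\<Sum>k\<in>?K. Polynomial.monom (c k) (monom_degree k)) = 0"
    using van unfolding c_def eval_poly_on_line by (intro iffD1[OF poly_all_0_iff_0]) simp
  then have coeff: "(\<Sum>k\<in>?K. if monom_degree k = d then c k else 0) = 0" for d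
    by (subst coeff_monom[symmetric], subst coeff_sum[symmetric]) simp
  have "(\<Sum>k\<in>?K. Const (c k) * lin n ^ monom_degree k) =
      (\<Sum>d\<in>monom_degree ` ?K. \<Sum>k | k \<in> ?K \<and> monom_degree k = d. Const (c k) * lin n ^ monom_degree k)"
    by (rule sum.group[symmetric]) auto
  also have "\<dots> = (\<Sum>d\<in>monom_degree ` ?K. Const (\<Sum>k | k \<in> ?K \<and> monom_degree k = d. c k) * lin n ^ d)"
    by (simp add: Const_sum sum_distrib_right)
  also have "\<dots> = 0"
    using coeff by (simp add: sum.inter_filter)
  finally have "(\<Sum>k\<in>?K. Poly_Mapping.single k (Poly_Mapping.lookup f k) -
      Const (c k) * lin n ^ monom_degree k) = f"
    using poly_mapping_eq_sum_single[of f] by (simp add: sum_subtractf)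
  moreover have "(\<Sum>k\<in>?K. Poly_Mapping.single k (Poly_Mapping.lookup f k) -
      Const (c k) * lin n ^ monom_degree k) \<in> ?I"
    by (rule ideal_gen2_sum) (rule single)
  ultimately show ?thesis
    by (simp only:)
qed

section \<open>Grids on lines in the plane\<close>

text \<open>Each form excludes at most one \<open>t\<close>, and the field is infinite.\<close>

lemma ex_common_nonzero:
  assumes "finite S" and "\<And>u. u \<in> S \<Longrightarrow> dot u v \<noteq> 0 \<or> dot u w \<noteq> 0"
  obtains t where "\<And>u. u \<in> S \<Longrightarrow> dot u (v + t *s w) \<noteq> 0"
proof -
  have "finite {t. dot u (v + t *s w) = 0}" if "u \<in> S" for u
  proof (cases "dot u w = 0")
    case True
    then show ?thesis using assms(2)[OF that] by simp
  next
    case False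
    then have "{t. dot u (v + t *s w) = 0} \<subseteq> {- dot u v / dot u w}"
      by (auto simp: field_simps add_eq_0_iff)
    then show ?thesis
      using finite_subset by blast
  qed
  then have "finite (\<Union>u\<in>S. {t. dot u (v + t *s w) = 0})"
    using assms(1) by blast
  then obtain t where "t \<notin> (\<Union>u\<in>S. {t. dot u (v + t *s w) = 0})"
    using ex_new_if_finite infinite_UNIV_char_0 by blast
  then show thesis
    using that by blast
qed

lemma dot_3: "dot u (v :: complex ^ 3) = u $ 1 * v $ 1 + u $ 2 * v $ 2 + u $ 3 * v $ 3"
  by (simp add: dot_def sum_3)

text \<open>Two non-proportional linear forms \<open>l\<close> and \<open>m\<close> have a one-dimensional common kernel: both are
  proportional to the cross product of any two vectors in it.\<close>

lemma common_kernel_3: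
  fixes l m v w y :: "complex ^ 3"
  assumes "v \<noteq> 0" "dot l v = 0" "dot m v = 0" "dot l w = 0" "dot m w \<noteq> 0" "l \<noteq> 0"
    and y: "dot l y = 0" "dot m y = 0"
  obtains c where "y = c *s v"
proof -
  \<comment> \<open>The cross product of \<open>y\<close> and \<open>v\<close>.\<close>
  define n :: "complex ^ 3" where "n = vector [y $ 2 * v $ 3 - y $ 3 * v $ 2,
    y $ 3 * v $ 1 - y $ 1 * v $ 3, y $ 1 * v $ 2 - y $ 2 * v $ 1]"
  have cross: "u $ i * n $ j = u $ j * n $ i" if "dot u y = 0" "dot u v = 0" for u i j
  proof -
    have "u $ 1 * n $ 2 = u $ 2 * n $ 1" "u $ 1 * n $ 3 = u $ 3 * n $ 1" "u $ 2 * n $ 3 = u $ 3 * n $ 2"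
      using that unfolding dot_3 n_def by (simp_all, algebra+)
    then show ?thesis
      using exhaust_3[of i] exhaust_3[of j] by auto
  qed
  obtain k where k: "l $ k \<noteq> 0"
    using \<open>l \<noteq> 0\<close> by (auto simp: vec_eq_iff)
  \<comment> \<open>Otherwise \<open>n\<close> is a multiple of \<open>l\<close> and
    \<open>m\<close> a multiple of \<open>n\<close>, so \<open>dot l w = 0\<close> would force
    \<open>dot m w = 0\<close>.\<close>
  have "n = 0"
  proof (rule ccontr)
    assume "n \<noteq> 0"
    have n: "n = (n $ k / l $ k) *s l"
      using cross[of l k] k assms by (auto simp: vec_eq_iff field_simps)
    with \<open>n \<noteq> 0\<close> have "n $ k \<noteq> 0"
      by auto
    have "dot n w = 0"
      by (subst n) (simp add: assms)
    moreover have "m = (m $ k / n $ k) *s n"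
      using cross[of m k] \<open>n $ k \<noteq> 0\<close> assms by (auto simp: vec_eq_iff field_simps)
    then have "dot m w = m $ k / n $ k * dot n w"
      by (metis dot_simps(5))
    ultimately show False
      using assms by simp
  qed
  then have "y $ 2 * v $ 3 = y $ 3 * v $ 2" "y $ 3 * v $ 1 = y $ 1 * v $ 3"
    "y $ 1 * v $ 2 = y $ 2 * v $ 1"
    by (auto simp: n_def vec_eq_iff forall_3)
  then have cross_y: "y $ i * v $ j = y $ j * v $ i" for i j
    using exhaust_3[of i] exhaust_3[of j] by auto
  obtain i where i: "v $ i \<noteq> 0"
    using \<open>v \<noteq> 0\<close> by (auto simp: vec_eq_iff)
  have "y = (y $ i / v $ i) *s v"
    using cross_y[of i] i by (simp add: vec_eq_iff field_simps)
  then show thesis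
    by (rule that)
qed

text \<open>In dimension three the decomposition asked for by \<open>mem_ideal_gen2_lin\<close> is
  automatic: removing the components along vectors dual to \<open>l\<close> and \<open>m\<close>
  leaves a vector of the common kernel, hence a multiple of \<open>v\<close>.\<close>

lemma mem_ideal_gen2_lin_3:
  fixes l m v w :: "complex ^ 3"
  assumes "v \<noteq> 0" "dot l v = 0" "dot m v = 0" "dot l w = 0" "dot m w \<noteq> 0" "l \<noteq> 0"
    and van: "\<And>t. eval_poly f (t *s v) = 0"
  shows "f \<in> ideal_gen2 (lin l) (lin m)"
proof -
  obtain k where k: "l $ k \<noteq> 0"
    using \<open>l \<noteq> 0\<close> by (auto simp: vec_eq_iff)
  define u :: "complex ^ 3" where "u = axis k 1"
  have u: "dot l u \<noteq> 0"
    using k by (simp add: u_def)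
  \<comment> \<open>Rescaling \<open>w\<close>, and correcting \<open>u\<close> along it, gives
    vectors dual to \<open>m\<close> and \<open>l\<close>.\<close>
  define \<beta> where "\<beta> = (1 / dot m w) *s w"
  define \<alpha> where "\<alpha> = (1 / dot l u) *s (u - dot m u *s \<beta>)"
  show ?thesis
  proof (rule mem_ideal_gen2_lin[OF \<open>v \<noteq> 0\<close> _ van])
    fix y
    let ?y = "y - dot l y *s \<alpha> - dot m y *s \<beta>"
    have "dot l \<beta> = 0" "dot m \<beta> = 1" "dot l \<alpha> = 1" "dot m \<alpha> = 0"
      using assms u by (simp_all add: \<alpha>_def \<beta>_def)
    then have "dot l ?y = 0" "dot m ?y = 0"
      by simp_all
    then obtain c where "?y = c *s v"
      using common_kernel_3[OF assms(1-6)] by blast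
    then have "y = c *s v + dot l y *s \<alpha> + dot m y *s \<beta>"
      by (simp add: algebra_simps)
    then show "\<exists>c. y = c *s v + dot l y *s \<alpha> + dot m y *s \<beta>" ..
  qed
qed

text \<open>On the line \<open>l = 0\<close> the forms \<open>m i\<close> are split off one at a
  time: the cofactor must vanish at the next point because the product of the earlier forms does
  not.\<close>

lemma mem_ideal_gen2_prod_lin:
  fixes l :: "complex ^ 3" and m v :: "'i \<Rightarrow> complex ^ 3"
  assumes "finite J" "l \<noteq> 0"
    and "\<And>i. i \<in> J \<Longrightarrow> v i \<noteq> 0" "\<And>i. i \<in> J \<Longrightarrow> dot l (v i) = 0" "\<And>i. i \<in> J \<Longrightarrow> dot (m i) (v i) = 0"
    and "\<And>i j. i \<in> J \<Longrightarrow> j \<in> J \<Longrightarrow> i \<noteq> j \<Longrightarrow> dot (m i) (v j) \<noteq> 0"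
    and "\<And>i. i \<in> J \<Longrightarrow> \<exists>w. dot l w = 0 \<and> dot (m i) w \<noteq> 0"
    and "\<And>i t. i \<in> J \<Longrightarrow> eval_poly f (t *s v i) = 0"
  shows "f \<in> ideal_gen2 (lin l) (\<Prod>i\<in>J. lin (m i))"
  using assms
proof (induction J rule: finite_induct)
  case empty
  have "f = 0 * lin l + f * 1"
    by simp
  then have "f \<in> ideal_gen2 (lin l) 1"
    unfolding ideal_gen2_def by blast
  then show ?case
    by simp
next
  case (insert x J)
  have "f \<in> ideal_gen2 (lin l) (\<Prod>i\<in>J. lin (m i))"
    by (rule insert.IH) (use insert.prems in auto)
  then obtain D A where f: "f = D * lin l + A * (\<Prod>i\<in>J. lin (m i))"
    unfolding ideal_gen2_def by blast
  have "eval_poly A (t *s v x) = 0" if "t \<noteq> 0" for t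
  proof -
    have "(\<Prod>i\<in>J. dot (m i) (t *s v x)) \<noteq> 0"
      using insert.hyps insert.prems(5)[of _ x] that by (auto simp: prod_zero_iff)
    moreover have "eval_poly f (t *s v x) = 0" "dot l (v x) = 0"
      using insert.prems by auto
    ultimately show ?thesis
      unfolding f by simp
  qed
  then have "eval_poly A (t *s v x) = 0" for t
    by (rule eval_poly_line_eq_0)
  moreover obtain w where "dot l w = 0" "dot (m x) w \<noteq> 0"
    using insert.prems(6)[of x] by blast
  ultimately have "A \<in> ideal_gen2 (lin l) (lin (m x))"
    using insert.prems(1-4) by (intro mem_ideal_gen2_lin_3[where v = "v x" and w = w]) simp_all
  then obtain a b where "A = a * lin l + b * lin (m x)"
    unfolding ideal_gen2_def by blast
  then have "f = (D + a * (\<Prod>i\<in>J. lin (m i))) * lin l + b * (\<Prod>i\<in>insert x J. lin (m i))"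
    using f insert.hyps by (simp add: algebra_simps)
  then show ?case
    unfolding ideal_gen2_def by blast
qed

section \<open>Saturation and complete intersections\<close>

lemma vanishes_at_span: "vanishes_at f (vec.span {v}) \<longleftrightarrow> (\<forall>t. eval_poly f (t *s v) = 0)"
  by (auto simp: vanishes_at_def vec.span_singleton)

text \<open>Multiplying \<open>f\<close> by the \<open>N\<close>-th power of a coordinate that is
  nonzero at the point brings it into the ideal without affecting whether it vanishes there.\<close>

lemma saturation_subset_vanishing_ideal:
  fixes v :: "'k \<Rightarrow> complex ^ 'n::finite"
  assumes "\<And>k. k \<in> K \<Longrightarrow> v k \<noteq> 0"
    and "\<And>k t. k \<in> K \<Longrightarrow> eval_poly F (t *s v k) = 0"
    and "\<And>k t. k \<in> K \<Longrightarrow> eval_poly G (t *s v k) = 0"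
  shows "saturation (ideal_gen2 F G) \<subseteq> vanishing_ideal ((\<lambda>k. vec.span {v k}) ` K)"
proof
  fix f assume "f \<in> saturation (ideal_gen2 F G)"
  then obtain N where N: "\<And>h. homogeneous N h \<Longrightarrow> h * f \<in> ideal_gen2 F G"
    unfolding saturation_def by blast
  have "eval_poly f (t *s v k) = 0" if "k \<in> K" for k t
  proof (rule eval_poly_line_eq_0)
    fix t :: complex assume "t \<noteq> 0"
    obtain i where i: "v k $ i \<noteq> 0"
      using assms(1)[OF \<open>k \<in> K\<close>] by (auto simp: vec_eq_iff)
    have "homogeneous N (Var i ^ N)"
      using homogeneous_power[OF homogeneous_Var, of N i] by simp
    then have "Var i ^ N * f \<in> ideal_gen2 F G"
      by (rule N)
    then obtain A B where "Var i ^ N * f = A * F + B * G"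
      unfolding ideal_gen2_def by blast
    from arg_cong[OF this, of "\<lambda>p. eval_poly p (t *s v k)"] show "eval_poly f (t *s v k) = 0"
      using assms(2,3)[OF \<open>k \<in> K\<close>] i \<open>t \<noteq> 0\<close> by simp
  qed
  then show "f \<in> vanishing_ideal ((\<lambda>k. vec.span {v k}) ` K)"
    by (simp add: vanishing_ideal_def vanishes_at_span)
qed

text \<open>Each line \<open>L k\<close> carries one row of points, and modulo \<open>L k\<close>
  the curve \<open>F\<close> cuts out that row. A polynomial vanishing on the grid even lies in
  \<open>ideal_gen2 F G\<close>, so saturation adds nothing.\<close>

lemma complete_intersection_grid:
  fixes L :: "'k \<Rightarrow> complex ^ 3" and M v :: "'k \<Rightarrow> 'i \<Rightarrow> complex ^ 3"
  assumes K: "finite K" "2 \<le> card K" and I: "finite I" "2 \<le> card I"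
    and v: "\<And>k i. k \<in> K \<Longrightarrow> i \<in> I \<Longrightarrow> v k i \<noteq> 0"
    and L0: "\<And>k i. k \<in> K \<Longrightarrow> i \<in> I \<Longrightarrow> dot (L k) (v k i) = 0"
    and L1: "\<And>j k i. j \<in> K \<Longrightarrow> k \<in> K \<Longrightarrow> i \<in> I \<Longrightarrow> j \<noteq> k \<Longrightarrow> dot (L j) (v k i) \<noteq> 0"
    and M0: "\<And>k i. k \<in> K \<Longrightarrow> i \<in> I \<Longrightarrow> dot (M k i) (v k i) = 0"
    and M1: "\<And>k i j. k \<in> K \<Longrightarrow> i \<in> I \<Longrightarrow> j \<in> I \<Longrightarrow> i \<noteq> j \<Longrightarrow> dot (M k i) (v k j) \<noteq> 0"
    and F: "homogeneous d F" "0 < d"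
    and c: "c \<noteq> 0" "\<And>k. k \<in> K \<Longrightarrow> \<exists>D. F = Const c * (\<Prod>i\<in>I. lin (M k i)) + D * lin (L k)"
  shows "complete_intersection d (card K) ((\<lambda>(k, i). vec.span {v k i}) ` (K \<times> I))"
proof -
  let ?X = "(\<lambda>(k, i). vec.span {v k i}) ` (K \<times> I)"
  define G where "G = (\<Prod>k\<in>K. lin (L k))"
  \<comment> \<open>A second row and a second point per row provide points at which a given
    \<open>L k\<close> or \<open>M k1 i\<close> is nonzero.\<close>
  obtain k1 k2 where k: "k1 \<in> K" "k2 \<in> K" "k1 \<noteq> k2"
    using K by (metis One_nat_def card_le_Suc0_iff_eq not_less_eq_eq numeral_2_eq_2)
  obtain i1 i2 where i: "i1 \<in> I" "i2 \<in> I" "i1 \<noteq> i2"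
    using I by (metis One_nat_def card_le_Suc0_iff_eq not_less_eq_eq numeral_2_eq_2)
  have Lnz: "L k \<noteq> 0" if "k \<in> K" for k
    using L1[OF that] k i that by (metis dot_simps(7))
  have F0: "eval_poly F (t *s v k i) = 0" if "k \<in> K" "i \<in> I" for k i t
  proof -
    have "(\<Prod>j\<in>I. t * dot (M k j) (v k i)) = 0"
      using that I M0[OF that] by (intro prod_zero) auto
    then show ?thesis
      using c(2)[OF that(1)] L0[OF that] by auto
  qed
  have G0: "eval_poly G (t *s v k i) = 0" if "k \<in> K" "i \<in> I" for k i t
    unfolding G_def using that K L0[OF that] by auto
  \<comment> \<open>On the line \<open>L k1\<close> only \<open>c\<close> times the product of the
    \<open>M k1 i\<close> survives, and some combination of two points of the row avoids all its
    zeros.\<close>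
  have "F \<noteq> 0"
  proof
    assume "F = 0"
    have "dot u (v k1 i1) \<noteq> 0 \<or> dot u (v k1 i2) \<noteq> 0" if "u \<in> M k1 ` I" for u
      using that k i M1[of k1] by auto
    then obtain t where t: "\<And>u. u \<in> M k1 ` I \<Longrightarrow> dot u (v k1 i1 + t *s v k1 i2) \<noteq> 0"
      using ex_common_nonzero[of "M k1 ` I"] I by (metis finite_imageI)
    obtain D where D: "F = Const c * (\<Prod>i\<in>I. lin (M k1 i)) + D * lin (L k1)"
      using c(2) k by blast
    have "0 = eval_poly F (v k1 i1 + t *s v k1 i2)"
      using \<open>F = 0\<close> by simp
    also have "\<dots> = c * (\<Prod>i\<in>I. dot (M k1 i) (v k1 i1 + t *s v k1 i2))"
      unfolding D using L0 k i by (simp del: dot_simps(2)) simp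
    finally show False
      using t c I by auto
  qed
  moreover have "homogeneous (card K) G"
    unfolding G_def using homogeneous_prod[of K "\<lambda>_. 1" "\<lambda>k. lin (L k)", OF homogeneous_lin] by simp
  moreover have "G \<noteq> 0"
  proof
    assume "G = 0"
    have "dot u (v k1 i1) \<noteq> 0 \<or> dot u (v k2 i1) \<noteq> 0" if "u \<in> L ` K" for u
      using that k i L1 by blast
    then obtain t where t: "\<And>u. u \<in> L ` K \<Longrightarrow> dot u (v k1 i1 + t *s v k2 i1) \<noteq> 0"
      using ex_common_nonzero[of "L ` K"] K by (metis finite_imageI)
    have "0 = eval_poly G (v k1 i1 + t *s v k2 i1)"
      using \<open>G = 0\<close> by simp
    then show False
      unfolding G_def using t K by (auto simp del: dot_simps(2))
  qed
  moreover have "saturation (ideal_gen2 F G) = vanishing_ideal ?X"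
  proof
    show "saturation (ideal_gen2 F G) \<subseteq> vanishing_ideal ?X"
      using saturation_subset_vanishing_ideal[of "K \<times> I" "\<lambda>(k, i). v k i" F G] v F0 G0
      by (auto simp: case_prod_unfold)
    show "vanishing_ideal ?X \<subseteq> saturation (ideal_gen2 F G)"
    proof
      fix f assume "f \<in> vanishing_ideal ?X"
      then have f: "eval_poly f (t *s v k i) = 0" if "k \<in> K" "i \<in> I" for k i t
        using that by (auto simp: vanishing_ideal_def vanishes_at_span)
      have "f \<in> ideal_gen2 F (\<Prod>k\<in>J. lin (L k))" if "finite J" "J \<subseteq> K" for J
        using that
      proof (induction J rule: finite_induct)
        case empty
        have "f = 0 * F + f * 1"
          by simp
        then have "f \<in> ideal_gen2 F 1"
          unfolding ideal_gen2_def by blast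
        then show ?case
          by simp
      next
        case (insert k J)
        let ?P = "\<Prod>j\<in>J. lin (L j)"
        obtain A B where AB: "f = A * F + B * ?P"
          using insert unfolding ideal_gen2_def by blast
        have "k \<in> K"
          using insert by blast
        \<comment> \<open>On row \<open>k\<close> both \<open>f\<close> and \<open>F\<close> vanish
          while the product of the other lines does not, so the cofactor vanishes there.\<close>
        have "eval_poly B (t *s v k i) = 0" if "i \<in> I" for i t
        proof (rule eval_poly_line_eq_0)
          fix t :: complex assume "t \<noteq> 0"
          then have "(\<Prod>j\<in>J. dot (L j) (t *s v k i)) \<noteq> 0"
            using insert.hyps insert.prems that L1 by (auto simp: prod_zero_iff)
          moreover have "eval_poly f (t *s v k i) = eval_poly A (t *s v k i) * eval_poly F (t *s v k i) +
              eval_poly B (t *s v k i) * (\<Prod>j\<in>J. dot (L j) (t *s v k i))"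
            by (simp add: AB)
          ultimately show "eval_poly B (t *s v k i) = 0"
            using f[OF \<open>k \<in> K\<close> that] F0[OF \<open>k \<in> K\<close> that] by simp
        qed
        moreover have "\<exists>w. dot (L k) w = 0 \<and> dot (M k i) w \<noteq> 0" if "i \<in> I" for i
          using that i L0[OF \<open>k \<in> K\<close>] M1[OF \<open>k \<in> K\<close>] by metis
        ultimately have "B \<in> ideal_gen2 (lin (L k)) (\<Prod>i\<in>I. lin (M k i))"
          using \<open>k \<in> K\<close> I v L0 M0 M1 Lnz
          by (intro mem_ideal_gen2_prod_lin[where v = "v k"]) auto
        then obtain a b where B: "B = a * lin (L k) + b * (\<Prod>i\<in>I. lin (M k i))"
          unfolding ideal_gen2_def by blast
        obtain D where D: "F = Const c * (\<Prod>i\<in>I. lin (M k i)) + D * lin (L k)"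
          using c(2) \<open>k \<in> K\<close> by blast
        \<comment> \<open>As \<open>c\<close> is invertible, the product of the \<open>M k i\<close>
          can be traded for a multiple of \<open>F\<close> modulo \<open>L k\<close>; this moves the
          factor \<open>L k\<close> into the product \<open>?P\<close>.\<close>
        have inv: "Const (1 / c) * Const c = (1 :: 3 mpoly)"
          using c(1) by (simp flip: Const_mult)
        have "(\<Prod>i\<in>I. lin (M k i)) = Const (1 / c) * Const c * (\<Prod>i\<in>I. lin (M k i))"
          by (simp add: inv)
        also have "\<dots> = Const (1 / c) * F - Const (1 / c) * D * lin (L k)"
          unfolding D by (simp add: algebra_simps)
        finally have "f = A * F + (a * lin (L k) + b * (Const (1 / c) * F - Const (1 / c) * D * lin (L k))) * ?P"
          using AB B by simp
        then have "f = (A + b * Const (1 / c) * ?P) * F +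
            (a - b * Const (1 / c) * D) * (\<Prod>j\<in>insert k J. lin (L j))"
          using insert.hyps by (simp add: algebra_simps)
        then show ?case
          unfolding ideal_gen2_def by blast
      qed
      then have "f \<in> ideal_gen2 F G"
        unfolding G_def using K by blast
      then show "f \<in> saturation (ideal_gen2 F G)"
        unfolding saturation_def using ideal_gen2_mult by blast
    qed
  qed
  ultimately show ?thesis
    unfolding complete_intersection_def plane_curve_def using F K by auto
qed

section \<open>Projections and general points\<close>

text \<open>After extending \<open>p\<close> to a basis, \<open>A\<close> is injective on the span
  of the other three vectors, so their images span the target. The section \<open>B\<close> later
  carries forms to the plane.\<close>

lemma projection_right_inverse:
  fixes A :: "complex ^ 4 ^ 3"
  assumes A: "projection_from (vec.span {p}) A" and "p \<noteq> 0"
  obtains B where "A ** B = mat 1"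
proof -
  have "vec.independent {p}"
    using \<open>p \<noteq> 0\<close> by simp
  then obtain C where C: "{p} \<subseteq> C" "vec.independent C" "UNIV \<subseteq> vec.span C"
    using vec.maximal_independent_subset_extend[of "{p}" UNIV] by (metis subset_UNIV)
  have "card C = 4"
    using vec.basis_card_eq_dim[of C UNIV] C by (simp add: card_cart_basis)
  then have card: "card (C - {p}) = 3"
    using C by simp
  have indep: "vec.independent (C - {p})"
    using C(2) vec.independent_mono by blast
  have "p \<notin> vec.span (C - {p})"
    using C by (auto simp: vec.dependent_def)
  have "inj_on ((*v) A) (vec.span (C - {p}))"
  proof (rule inj_onI)
    fix x y assume xy: "x \<in> vec.span (C - {p})" "y \<in> vec.span (C - {p})" "A *v x = A *v y"
    then have "A *v (x - y) = 0"
      by (simp add: matrix_vector_mult_diff_distrib)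
    then have "x - y \<in> vec.span {p}"
      using A unfolding projection_from_def by blast
    then obtain c where c: "x - y = c *s p"
      by (auto simp: vec.span_singleton)
    show "x = y"
    proof (rule ccontr)
      assume "x \<noteq> y"
      then have "c \<noteq> 0"
        using c by auto
      then have "p = (1 / c) *s (x - y)"
        using c by simp
      also have "\<dots> \<in> vec.span (C - {p})"
        using xy by (intro vec.span_scale vec.span_diff)
      finally show False
        using \<open>p \<notin> _\<close> by simp
    qed
  qed
  then have "vec.dim ((*v) A ` (C - {p})) = vec.dim (C - {p})"
    by (intro vec.dim_image_eq matrix_vector_mul_linear_gen)
  also have "\<dots> = 3"
    using card indep by (simp add: vec.dim_eq_card_independent)
  finally have "vec.span ((*v) A ` (C - {p})) = UNIV"
    using vec.dim_eq_full[of "(*v) A ` (C - {p})"] by (simp add: card_cart_basis vec.dimension_def)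
  moreover have "vec.span ((*v) A ` (C - {p})) \<subseteq> range ((*v) A)"
    by (metis vec.linear_span_image matrix_vector_mul_linear_gen image_mono subset_UNIV)
  ultimately have "surj ((*v) A)"
    by auto
  then show thesis
    using that matrix_right_invertible_surjective by blast
qed

text \<open>The complement of the hyperplanes in \<open>S\<close> is open, being the nonvanishing
  locus of one product, so a single good centre \<open>p0\<close> suffices.\<close>

lemma for_general_point_avoiding:
  fixes p0 :: "complex ^ 'n::finite"
  assumes "finite S" "p0 \<noteq> 0" "\<And>u. u \<in> S \<Longrightarrow> dot u p0 \<noteq> 0"
    and Q: "\<And>p. p \<noteq> 0 \<Longrightarrow> (\<And>u. u \<in> S \<Longrightarrow> dot u p \<noteq> 0) \<Longrightarrow> Q (vec.span {p})"
  shows "for_general_point Q"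
proof -
  define H where "H = (\<Prod>u\<in>S. lin u)"
  define U where "U = {P \<in> proj_space. \<not> vanishes_at H P}"
  have "homogeneous (card S) H"
    unfolding H_def using homogeneous_prod[of S "\<lambda>_. 1" lin, OF homogeneous_lin] by simp
  moreover have "proj_space - U = {P \<in> proj_space. \<forall>f\<in>{H}. vanishes_at f P}"
    by (auto simp: U_def)
  ultimately have "zariski_closed (proj_space - U)"
    unfolding zariski_closed_def by blast
  then have "zariski_open U"
    by (auto simp: zariski_open_def U_def)
  moreover have "vec.span {p0} \<in> U"
  proof -
    have "eval_poly H (1 *s p0) \<noteq> 0"
      using assms by (simp add: H_def)
    then have "\<not> vanishes_at H (vec.span {p0})"
      unfolding vanishes_at_span by blast
    then show ?thesis
      using assms by (auto simp: U_def proj_space_def)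
  qed
  moreover have "Q P" if "P \<in> U" for P
  proof -
    have "P \<in> proj_space"
      using that by (simp add: U_def)
    then obtain p where p: "p \<noteq> 0" "P = vec.span {p}"
      unfolding proj_space_def by blast
    have "\<not> vanishes_at H (vec.span {p})"
      using that p by (simp add: U_def)
    then obtain t where "eval_poly H (t *s p) \<noteq> 0"
      unfolding vanishes_at_span by blast
    then show ?thesis
      using p Q[of p] assms(1) by (auto simp: H_def)
  qed
  ultimately show ?thesis
    unfolding for_general_point_def by blast
qed

lemma for_general_point_mono:
  "for_general_point Q \<Longrightarrow> (\<And>P. Q P \<Longrightarrow> R P) \<Longrightarrow> for_general_point R"
  unfolding for_general_point_def by blast

section \<open>The Klein configuration\<close>

text \<open>Klein coordinates of the line through \<open>p\<close> and \<open>v\<close>: with Pluecker coordinates \<open>p\<^sub>a\<^sub>b\<close> they are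
  \<open>p\<^sub>1\<^sub>2 + p\<^sub>3\<^sub>4\<close>, \<open>\<i> (p\<^sub>1\<^sub>2 - p\<^sub>3\<^sub>4)\<close>, \<open>p\<^sub>1\<^sub>3 + p\<^sub>4\<^sub>2\<close>, \<open>\<i> (p\<^sub>1\<^sub>3 - p\<^sub>4\<^sub>2)\<close>, \<open>p\<^sub>1\<^sub>4 + p\<^sub>2\<^sub>3\<close>,
  \<open>\<i> (p\<^sub>1\<^sub>4 - p\<^sub>2\<^sub>3)\<close>, each written as a linear form in \<open>v\<close>.\<close>

definition klein_form :: "nat \<Rightarrow> complex ^ 4 \<Rightarrow> complex ^ 4" where
  "klein_form n p = [vector [- p $ 2, p $ 1, - p $ 4, p $ 3],
     vector [- \<i> * p $ 2, \<i> * p $ 1, \<i> * p $ 4, - \<i> * p $ 3],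
     vector [- p $ 3, p $ 4, p $ 1, - p $ 2],
     vector [- \<i> * p $ 3, - \<i> * p $ 4, \<i> * p $ 1, \<i> * p $ 2],
     vector [- p $ 4, - p $ 3, p $ 2, p $ 1],
     vector [- \<i> * p $ 4, \<i> * p $ 3, - \<i> * p $ 2, \<i> * p $ 1]] ! n"

text \<open>In the forms below the parity of the index selects the sign, and its half selects the
  pair of Klein coordinates.\<close>

definition sqrt_minus_one :: "nat \<Rightarrow> complex" where
  "sqrt_minus_one n = (if even n then \<i> else - \<i>)"

text \<open>The vanishing of \<open>x\<^sub>0 - \<epsilon> x\<^sub>j\<close> with \<open>\<epsilon> = \<plusminus>\<i>\<close> and \<open>1 \<le> j \<le> 5\<close> says that the line through \<open>p\<close>
  and \<open>v\<close> meets a fixed line; the ten fixed lines obtained in this way are pairwise skew.\<close>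

definition line_form :: "nat \<Rightarrow> complex ^ 4 \<Rightarrow> complex ^ 4" where
  "line_form k p = klein_form 0 p - sqrt_minus_one k *s klein_form (k div 2 + 1) p"

text \<open>On the \<open>k\<close>-th line the sextic splits into the six forms \<open>x\<^sub>a \<mp> \<i> x\<^sub>b\<close>, where \<open>a\<close> and \<open>b\<close> range
  over three of the four remaining indices.\<close>

definition point_form :: "nat \<Rightarrow> nat \<Rightarrow> complex ^ 4 \<Rightarrow> complex ^ 4" where
  "point_form k i p = (let r = (\<lambda>n. if n \<le> k div 2 then n else n + 1) in
     klein_form (r ([1, 1, 2] ! (i div 2))) p -
     sqrt_minus_one i *s klein_form (r ([2, 3, 3] ! (i div 2))) p)"

text \<open>Row \<open>k\<close> lists the points on the \<open>k\<close>-th line, ordered so that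
  \<open>point_form k i p\<close> vanishes at entry \<open>i\<close> for every centre
  \<open>p\<close>.\<close>

definition klein_points :: "(complex ^ 4) list list" where
  "klein_points = [
[vector [0, 0, 0, 1], vector [0, 0, 1, 0], vector [0, 0, 1, -\<i>], vector [0, 0, 1, \<i>], vector [0, 0, 1, 1], vector [0, 0, 1, -1]],
[vector [0, 1, 0, 0], vector [1, 0, 0, 0], vector [1, -\<i>, 0, 0], vector [1, \<i>, 0, 0], vector [1, 1, 0, 0], vector [1, -1, 0, 0]],
[vector [0, 1, -\<i>, 0], vector [1, 0, 0, -\<i>], vector [1, -\<i>, -1, -\<i>], vector [1, \<i>, 1, -\<i>], vector [1, 1, -\<i>, -\<i>], vector [1, -1, \<i>, -\<i>]],
[vector [1, 0, 0, \<i>], vector [0, 1, \<i>, 0], vector [1, \<i>, -1, \<i>], vector [1, -\<i>, 1, \<i>], vector [1, 1, \<i>, \<i>], vector [1, -1, -\<i>, \<i>]],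
[vector [1, 0, 0, 1], vector [0, 1, -1, 0], vector [1, 1, -1, 1], vector [1, -1, 1, 1], vector [1, -\<i>, \<i>, 1], vector [1, \<i>, -\<i>, 1]],
[vector [0, 1, 1, 0], vector [1, 0, 0, -1], vector [1, -1, -1, -1], vector [1, 1, 1, -1], vector [1, -\<i>, -\<i>, -1], vector [1, \<i>, \<i>, -1]],
[vector [1, \<i>, \<i>, 1], vector [1, -\<i>, \<i>, -1], vector [1, -1, \<i>, \<i>], vector [1, 1, \<i>, -\<i>], vector [0, 1, 0, -\<i>], vector [1, 0, \<i>, 0]],
[vector [1, -\<i>, -\<i>, 1], vector [1, \<i>, -\<i>, -1], vector [1, 1, -\<i>, \<i>], vector [1, -1, -\<i>, -\<i>], vector [0, 1, 0, \<i>], vector [1, 0, -\<i>, 0]],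
[vector [1, -1, -1, 1], vector [1, 1, -1, -1], vector [1, -\<i>, -1, \<i>], vector [1, \<i>, -1, -\<i>], vector [0, 1, 0, -1], vector [1, 0, -1, 0]],
[vector [1, 1, 1, 1], vector [1, -1, 1, -1], vector [1, \<i>, 1, \<i>], vector [1, -\<i>, 1, -\<i>], vector [0, 1, 0, 1], vector [1, 0, 1, 0]]]"

definition klein_point :: "nat \<Rightarrow> nat \<Rightarrow> complex ^ 4" where
  "klein_point k i = klein_points ! k ! i"

lemma dot_4: "dot u (v :: complex ^ 4) = u $ 1 * v $ 1 + u $ 2 * v $ 2 + u $ 3 * v $ 3 + u $ 4 * v $ 4"
  by (simp add: dot_def sum_4)

lemma vector_4 [simp]:
  "(vector [x, y, z, w] :: ('a::zero) ^ 4) $ 1 = x"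
  "(vector [x, y, z, w] :: ('a::zero) ^ 4) $ 2 = y"
  "(vector [x, y, z, w] :: ('a::zero) ^ 4) $ 3 = z"
  "(vector [x, y, z, w] :: ('a::zero) ^ 4) $ 4 = w"
  unfolding vector_def by simp_all

lemma less_6_cases: "i < 6 \<longleftrightarrow> i = 0 \<or> i = 1 \<or> i = 2 \<or> i = 3 \<or> i = 4 \<or> i = (5::nat)"
  by auto

lemma less_10_cases:
  "k < 10 \<longleftrightarrow> k = 0 \<or> k = 1 \<or> k = 2 \<or> k = 3 \<or> k = 4 \<or> k = 5 \<or> k = 6 \<or> k = 7 \<or> k = 8 \<or> k = (9::nat)"
  by auto

text \<open>Klein coordinates are alternating in the two points spanning a line. Hence centre and
  point can exchange roles, and each form vanishes at its own centre.\<close>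

lemma klein_form_skew: "n < 6 \<Longrightarrow> dot (klein_form n p) q = - dot (klein_form n q) p"
  by (auto simp: less_6_cases klein_form_def dot_4 algebra_simps)

text \<open>As \<open>(x + y)^2 - (x - y)^2 = 4 * x * y\<close>, the sum of the squares is four
  times the Pluecker relation; these are the entries of its matrix as a quadratic form in the second
  point.\<close>

lemma klein_form_quadric: "(\<Sum>n<6. klein_form n p $ a * klein_form n p $ b) = 0"
proof -
  have "{..<6} = {0, 1, 2, 3, 4, 5::nat}"
    by auto
  moreover have "\<i> * x * (\<i> * y) = - (x * y)" for x y
    by (simp add: algebra_simps)
  ultimately show ?thesis
    using exhaust_4[of a] exhaust_4[of b] by (elim disjE; simp add: klein_form_def)
qed

lemma line_form_skew:
  assumes "k < 10"
  shows "dot (line_form k p) q = - dot (line_form k q) p"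
proof -
  have "k div 2 + 1 < 6"
    using assms by auto
  then show ?thesis
    using klein_form_skew[of 0 p q] klein_form_skew[of "k div 2 + 1" p q]
    by (simp add: line_form_def)
qed

lemma point_form_skew:
  assumes "k < 10" "i < 6"
  shows "dot (point_form k i p) q = - dot (point_form k i q) p"
proof -
  have "[1, 1, 2] ! (i div 2) \<le> (3::nat)" "[2, 3, 3] ! (i div 2) \<le> (3::nat)"
    using assms(2) unfolding less_6_cases by auto
  then show ?thesis
    using assms(1) klein_form_skew[of _ p q] by (simp add: point_form_def Let_def)
qed

text \<open>Explicit index sets let this unfold into one equation for each of the sixty
  points.\<close>

lemma klein_point_eq_nth:
  "\<forall>k\<in>{0, 1, 2, 3, 4, 5, 6, 7, 8, 9}. \<forall>i\<in>{0, 1, 2, 3, 4, 5}. klein_point k i = klein_points ! k ! i"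
  by (simp add: klein_point_def)

lemmas klein_point_simps = klein_point_eq_nth[unfolded klein_points_def, simplified]

lemma klein_point_on_line: "k < 10 \<Longrightarrow> i < 6 \<Longrightarrow> dot (line_form k p) (klein_point k i) = 0"
  unfolding less_10_cases less_6_cases
  by (elim disjE; simp add: klein_point_simps line_form_def sqrt_minus_one_def
      klein_form_def dot_4 algebra_simps)

lemma klein_point_on_point_form: "k < 10 \<Longrightarrow> i < 6 \<Longrightarrow> dot (point_form k i p) (klein_point k i) = 0"
  unfolding less_10_cases less_6_cases
  by (elim disjE; simp add: klein_point_simps point_form_def sqrt_minus_one_def
      klein_form_def dot_4 algebra_simps)

text \<open>Found by search: none of the forms \<open>x\<^sub>a \<mp> \<i> x\<^sub>b\<close> vanishes at the line joining this point to a
  configuration point \<open>q\<close>, unless it vanishes on all lines through \<open>q\<close>.\<close>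

definition base_point :: "complex ^ 4" where
  "base_point = vector [1, 2, 3, 5]"

text \<open>Both sides use the representatives with first nonzero coordinate 1, so they agree as
  explicit finite sets of spans.\<close>

lemma klein_configuration_eq:
  "klein_configuration = (\<lambda>(k, i). vec.span {klein_point k i}) ` ({..<10} \<times> {..<6})"
proof -
  have "{..<10} = {0, 1, 2, 3, 4, 5, 6, 7, 8, 9::nat}" "{..<6} = {0, 1, 2, 3, 4, 5::nat}"
    by auto
  then have "(\<lambda>(k, i). vec.span {klein_point k i}) ` ({..<10} \<times> {..<6}) =
      (\<Union>k\<in>{0, 1, 2, 3, 4, 5, 6, 7, 8, 9}. \<Union>i\<in>{0, 1, 2, 3, 4, 5}. {vec.span {klein_point k i}})"
    by (simp only: ) blast
  also have "\<dots> = klein_configuration"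
    unfolding klein_configuration_def pt_def klein_point_def klein_points_def
    by (rule subset_antisym; simp)
  finally show ?thesis ..
qed

text \<open>The identity behind the splitting is \<open>u\<^sup>3 + v\<^sup>3 + w\<^sup>3 - (u + v + w)\<^sup>3 = - 3 (u + v) (u + w) (v + w)\<close>,
  applied to squares.\<close>

lemma sextic_splits:
  fixes x y a b c d e i :: "'a :: comm_ring_1"
  assumes "x\<^sup>2 + y\<^sup>2 + a\<^sup>2 + b\<^sup>2 + c\<^sup>2 + d\<^sup>2 = 0" "e\<^sup>2 = -1" "i\<^sup>2 = -1"
  shows "x ^ 6 + y ^ 6 + a ^ 6 + b ^ 6 + c ^ 6 + d ^ 6 =
    - 3 * ((a - i * b) * (a + i * b) * (a - i * c) * (a + i * c) * (b - i * c) * (b + i * c)) +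
    (x + e * y) * (x ^ 4 - x\<^sup>2 * y\<^sup>2 + y ^ 4 - 3 * (a\<^sup>2 + b\<^sup>2 + c\<^sup>2)\<^sup>2
      - 3 * (a\<^sup>2 + b\<^sup>2 + c\<^sup>2) * (x\<^sup>2 + y\<^sup>2) - (x\<^sup>2 + y\<^sup>2)\<^sup>2) * (x - e * y)"
proof -
  have d: "d\<^sup>2 = - (x\<^sup>2 + y\<^sup>2 + a\<^sup>2 + b\<^sup>2 + c\<^sup>2)"
    using assms(1) by (simp add: eq_neg_iff_add_eq_0 algebra_simps)
  have prod: "(u + r * w) * (u - r * w) = u\<^sup>2 + w\<^sup>2" if "r\<^sup>2 = -1" for u w r :: 'a
  proof -
    have "(u + r * w) * (u - r * w) = u\<^sup>2 - r\<^sup>2 * w\<^sup>2"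
      by (simp add: algebra_simps power2_eq_square)
    then show ?thesis
      by (simp add: that)
  qed
  have power: "u ^ 6 = (u\<^sup>2) ^ 3" "u ^ 4 = (u\<^sup>2) ^ 2" for u :: 'a
    by (simp_all flip: power_mult)
  have "(a - i * b) * (a + i * b) * (a - i * c) * (a + i * c) * (b - i * c) * (b + i * c) =
      ((a + i * b) * (a - i * b)) * ((a + i * c) * (a - i * c)) * ((b + i * c) * (b - i * c))"
    by (simp only: mult_ac)
  also have "\<dots> = (a\<^sup>2 + b\<^sup>2) * (a\<^sup>2 + c\<^sup>2) * (b\<^sup>2 + c\<^sup>2)"
    by (simp only: prod[OF assms(3)])
  finally have abc: "(a - i * b) * (a + i * b) * (a - i * c) * (a + i * c) * (b - i * c) * (b + i * c) =
      (a\<^sup>2 + b\<^sup>2) * (a\<^sup>2 + c\<^sup>2) * (b\<^sup>2 + c\<^sup>2)" .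
  have xy: "(x + e * y) * D * (x - e * y) = (x\<^sup>2 + y\<^sup>2) * D" for D
    unfolding prod[OF assms(2), symmetric] by (simp only: mult_ac)
  \<comment> \<open>\<open>X ^ 3 + Y ^ 3\<close> and all terms of the last cube except that of
    \<open>(A + B + C) ^ 3\<close> are divisible by \<open>X + Y\<close>; the rest is the identity
    in three variables.\<close>
  have "X ^ 3 + Y ^ 3 + A ^ 3 + B ^ 3 + C ^ 3 + (- (X + Y + A + B + C)) ^ 3 =
      - 3 * ((A + B) * (A + C) * (B + C)) +
      (X + Y) * (X\<^sup>2 - X * Y + Y\<^sup>2 - 3 * (A + B + C)\<^sup>2 - 3 * (A + B + C) * (X + Y) - (X + Y)\<^sup>2)"
    for X Y A B C :: 'a
    by (simp add: algebra_simps power2_eq_square power3_eq_cube)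
  from this[of "x\<^sup>2" "y\<^sup>2" "a\<^sup>2" "b\<^sup>2" "c\<^sup>2"] show ?thesis
    unfolding abc xy d power .
qed

section \<open>Nondegeneracy at the base point\<close>

lemma klein_form_base_point:
  "dot (klein_form 0 q) base_point = 2 * q $ 1 - q $ 2 + 5 * q $ 3 - 3 * q $ 4"
  "dot (klein_form (Suc 0) q) base_point = \<i> * (2 * q $ 1 - q $ 2 - 5 * q $ 3 + 3 * q $ 4)"
  "dot (klein_form 2 q) base_point = 3 * q $ 1 - 5 * q $ 2 - q $ 3 + 2 * q $ 4"
  "dot (klein_form 3 q) base_point = \<i> * (3 * q $ 1 + 5 * q $ 2 - q $ 3 - 2 * q $ 4)"
  "dot (klein_form 4 q) base_point = 5 * q $ 1 + 3 * q $ 2 - 2 * q $ 3 - q $ 4"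
  "dot (klein_form 5 q) base_point = \<i> * (5 * q $ 1 - 3 * q $ 2 + 2 * q $ 3 - q $ 4)"
  by (simp_all add: klein_form_def base_point_def dot_4 algebra_simps)

text \<open>A finite check. Geometrically, the line from \<open>base_point\<close> to a point of row
  \<open>k\<close> meets none of the other nine fixed lines.\<close>

lemma line_form_base_point:
  assumes "k < 10" "i < 6" "j < 10" "j \<noteq> k"
  shows "dot (line_form j (klein_point k i)) base_point \<noteq> 0"
  using assms unfolding less_10_cases less_6_cases
  by (elim disjE; simp add: klein_point_simps line_form_def sqrt_minus_one_def
      klein_form_base_point complex_eq_iff flip: numeral_2_eq_2)

text \<open>A finite check that, seen from \<open>base_point\<close>, the form of one point in a row
  separates it from the other five.\<close>

lemma point_form_base_point:
  assumes "k < 10" "i < 6" "j < 6" "i \<noteq> j"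
  shows "dot (point_form k i (klein_point k j)) base_point \<noteq> 0"
  using assms unfolding less_10_cases less_6_cases
  by (elim disjE; simp add: klein_point_simps point_form_def sqrt_minus_one_def
      klein_form_base_point complex_eq_iff flip: numeral_2_eq_2)

section \<open>Pulling the forms back to the plane\<close>

lemma vector_matrix_mult_linear:
  fixes u w :: "complex ^ 'm" and B :: "complex ^ 'n ^ 'm"
  shows "(u - c *s w) v* B = u v* B - c *s (w v* B)"
  by (rule dot_left_eqI) (simp add: dot_vector_matrix_mult)

text \<open>Coefficients of each \<open>Var a * Var b\<close> cancel, which yields an identity of
  polynomials rather than of values.\<close>

lemma sum_lin_squares_eq_0:
  assumes "\<And>a b. (\<Sum>n\<in>S. c n $ a * c n $ b) = 0"
  shows "(\<Sum>n\<in>S. (lin (c n))\<^sup>2) = 0"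
proof -
  have "(\<Sum>n\<in>S. (lin (c n))\<^sup>2) =
      (\<Sum>n\<in>S. \<Sum>a\<in>UNIV. \<Sum>b\<in>UNIV. Const (c n $ a * c n $ b) * (Var a * Var b))"
    by (simp add: lin_def power2_eq_square sum_product Const_mult mult_ac)
  also have "\<dots> = (\<Sum>a\<in>UNIV. \<Sum>b\<in>UNIV. Const (\<Sum>n\<in>S. c n $ a * c n $ b) * (Var a * Var b))"
    by (simp add: Const_sum sum_distrib_right sum.swap[of _ _ S])
  finally show ?thesis
    by (simp add: assms)
qed

lemma klein_form_quadric_lin: "(\<Sum>n<6. (lin (klein_form n p v* B))\<^sup>2) = 0"
proof (rule sum_lin_squares_eq_0)
  fix a b
  have "(\<Sum>n<6. (klein_form n p v* B) $ a * (klein_form n p v* B) $ b) =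
      (\<Sum>n<6. \<Sum>c\<in>UNIV. \<Sum>d\<in>UNIV. B $ c $ a * B $ d $ b * (klein_form n p $ c * klein_form n p $ d))"
    by (simp add: vector_matrix_mult_def sum_product mult_ac)
  also have "\<dots> = (\<Sum>c\<in>UNIV. \<Sum>d\<in>UNIV. B $ c $ a * B $ d $ b *
      (\<Sum>n<6. klein_form n p $ c * klein_form n p $ d))"
    by (simp add: sum_distrib_left sum.swap[of _ _ "{..<6}"])
  finally show "(\<Sum>n<6. (klein_form n p v* B) $ a * (klein_form n p v* B) $ b) = 0"
    by (simp add: klein_form_quadric)
qed

text \<open>For a section \<open>B\<close> of the projection this is the plane equation of the
  sextic cone with vertex \<open>p\<close>.\<close>

definition klein_sextic :: "complex ^ 4 \<Rightarrow> complex ^ 3 ^ 4 \<Rightarrow> 3 mpoly" where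
  "klein_sextic p B = (\<Sum>n<6. lin (klein_form n p v* B) ^ 6)"

lemma klein_sextic_splits:
  assumes "k < 10"
  shows "\<exists>D. klein_sextic p B =
    Const (- 3) * (\<Prod>i<6. lin (point_form k i p v* B)) + D * lin (line_form k p v* B)"
proof -
  \<comment> \<open>\<open>r 1\<close>, ..., \<open>r 4\<close> are the indices other than
    \<open>0\<close> and \<open>k div 2 + 1\<close>; \<open>X (r 4)\<close>, absent from the six
    point forms, is the one eliminated by the quadric.\<close>
  define r where "r = (\<lambda>n. if n \<le> k div 2 then n else n + 1)"
  define X where "X = (\<lambda>n. lin (klein_form n p v* B))"
  have six: "{..<6} = {0, 1, 2, 3, 4, 5::nat}"
    by auto
  have sum: "(\<Sum>n<6. h n) = h 0 + h (k div 2 + 1) + h (r 1) + h (r 2) + h (r 3) + h (r 4)"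
    for h :: "nat \<Rightarrow> 3 mpoly"
    using assms unfolding less_10_cases six r_def
    by (elim disjE; simp add: add_ac flip: numeral_2_eq_2)
  have "(sqrt_minus_one k)\<^sup>2 = - 1"
    by (simp add: sqrt_minus_one_def)
  then have e: "(Const (sqrt_minus_one k))\<^sup>2 = (- 1 :: 3 mpoly)"
    by (simp add: Const_uminus flip: Const_power)
  have i: "(Const \<i>)\<^sup>2 = (- 1 :: 3 mpoly)"
    by (simp add: Const_uminus flip: Const_power)
  have quadric: "(X 0)\<^sup>2 + (X (k div 2 + 1))\<^sup>2 + (X (r 1))\<^sup>2 + (X (r 2))\<^sup>2 + (X (r 3))\<^sup>2 + (X (r 4))\<^sup>2 = 0"
    using klein_form_quadric_lin[of p B] sum[of "\<lambda>n. (X n)\<^sup>2"] by (simp add: X_def)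
  have line: "lin (line_form k p v* B) = X 0 - Const (sqrt_minus_one k) * X (k div 2 + 1)"
    by (simp add: line_form_def vector_matrix_mult_linear lin_diff lin_scale X_def)
  have "lin (point_form k i p v* B) =
      X (r ([1, 1, 2] ! (i div 2))) - Const (sqrt_minus_one i) * X (r ([2, 3, 3] ! (i div 2)))" for i
    unfolding point_form_def Let_def X_def r_def
    by (simp only: vector_matrix_mult_linear lin_diff lin_scale)
  then have points: "(\<Prod>i<6. lin (point_form k i p v* B)) =
      (X (r 1) - Const \<i> * X (r 2)) * (X (r 1) + Const \<i> * X (r 2)) *
      (X (r 1) - Const \<i> * X (r 3)) * (X (r 1) + Const \<i> * X (r 3)) *
      (X (r 2) - Const \<i> * X (r 3)) * (X (r 2) + Const \<i> * X (r 3))"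
    by (simp add: six sqrt_minus_one_def Const_uminus mult_ac)
  have sextic: "klein_sextic p B =
      X 0 ^ 6 + X (k div 2 + 1) ^ 6 + X (r 1) ^ 6 + X (r 2) ^ 6 + X (r 3) ^ 6 + X (r 4) ^ 6"
    using sum[of "\<lambda>n. X n ^ 6"] by (simp add: klein_sextic_def X_def)
  have const: "Const (- 3) = (- 3 :: 3 mpoly)"
    by (simp add: Const_uminus Const_numeral)
  show ?thesis
    unfolding sextic points line const by (rule exI) (rule sextic_splits[OF quadric e i])
qed

lemma ex_other_index: "\<exists>j. j < 10 \<and> j \<noteq> (k :: nat)"
  by presburger

lemma klein_point_nonzero:
  assumes "k < 10" "i < 6"
  shows "klein_point k i \<noteq> 0"
proof
  assume 0: "klein_point k i = 0"
  obtain j :: nat where j: "j < 10" "j \<noteq> k"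
    using ex_other_index by blast
  have "dot (line_form j (klein_point k i)) base_point = 0"
    unfolding 0 by (simp add: line_form_skew[OF j(1), of 0])
  then show False
    using line_form_base_point[OF assms j] by simp
qed

lemma klein_projection:
  assumes A: "projection_from (vec.span {p}) A" and "p \<noteq> 0"
    and line: "\<And>j k i. j < 10 \<Longrightarrow> k < 10 \<Longrightarrow> i < 6 \<Longrightarrow> j \<noteq> k \<Longrightarrow> dot (line_form j p) (klein_point k i) \<noteq> 0"
    and point: "\<And>k i j. k < 10 \<Longrightarrow> i < 6 \<Longrightarrow> j < 6 \<Longrightarrow> i \<noteq> j \<Longrightarrow> dot (point_form k i p) (klein_point k j) \<noteq> 0"
  shows "complete_intersection 6 10 (proj_image A klein_configuration)"
proof -
  obtain B where B: "A ** B = mat 1"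
    using projection_right_inverse[OF A \<open>p \<noteq> 0\<close>] .
  \<comment> \<open>\<open>B *v (A *v q)\<close> differs from \<open>q\<close> by a multiple of
    \<open>p\<close>, so forms vanishing at \<open>p\<close> descend to the plane with the same
    values.\<close>
  have pull: "dot (u v* B) (A *v q) = dot u q" if "dot u p = 0" for u q
  proof -
    have "A *v (B *v (A *v q) - q) = 0"
      by (simp add: matrix_vector_mult_diff_distrib matrix_vector_mul_assoc matrix_mul_assoc B)
    then have "B *v (A *v q) - q \<in> vec.span {p}"
      using A unfolding projection_from_def by blast
    then obtain c where "B *v (A *v q) - q = c *s p"
      by (auto simp: vec.span_singleton)
    then have "B *v (A *v q) = q + c *s p"
      by (simp add: algebra_simps)
    then show ?thesis
      by (simp add: dot_vector_matrix_mult that)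
  qed
  have lp: "dot (line_form k p) p = 0" if "k < 10" for k
    using line_form_skew[OF that, of p p] by simp
  have pp: "dot (point_form k i p) p = 0" if "k < 10" "i < 6" for k i
    using point_form_skew[OF that, of p p] by simp
  have "complete_intersection 6 (card {..<10::nat})
      ((\<lambda>(k, i). vec.span {A *v klein_point k i}) ` ({..<10} \<times> {..<6}))"
  proof (rule complete_intersection_grid[where L = "\<lambda>k. line_form k p v* B" and c = "- 3"
        and M = "\<lambda>k i. point_form k i p v* B" and F = "klein_sextic p B"])
    fix k i :: nat assume ki: "k \<in> {..<10}" "i \<in> {..<6}"
    obtain j :: nat where j: "j < 10" "j \<noteq> k"
      using ex_other_index by blast
    \<comment> \<open>The form of another line \<open>j\<close> descends and is nonzero at this
      point, so the image cannot be zero.\<close>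
    show "A *v klein_point k i \<noteq> 0"
    proof
      assume "A *v klein_point k i = 0"
      then have "dot (line_form j p) (klein_point k i) = 0"
        using pull[OF lp, of j "klein_point k i"] j by simp
      then show False
        using line j ki by simp
    qed
  next
    have "homogeneous (6 * 1) (lin (klein_form n p v* B) ^ 6)" for n
      by (intro homogeneous_power homogeneous_lin)
    then show "homogeneous 6 (klein_sextic p B)"
      unfolding klein_sextic_def by (intro homogeneous_sum) simp
  qed (use klein_sextic_splits in \<open>auto simp: pull lp pp line point klein_point_on_line klein_point_on_point_form\<close>)
  moreover have "(*v) A ` vec.span {q} = vec.span {A *v q}" for q
    by (auto simp: vec.span_singleton vec.scale matrix_vector_mult_scaleR image_iff)
  then have "proj_image A klein_configuration =
      (\<lambda>(k, i). vec.span {A *v klein_point k i}) ` ({..<10} \<times> {..<6})"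
    unfolding proj_image_def klein_configuration_eq image_image by (simp add: case_prod_unfold)
  ultimately show ?thesis
    by simp
qed

theorem theorem5p5:
  shows "geproci klein_configuration \<and>
    for_general_point (\<lambda>P. P \<notin> klein_configuration \<and>
      (\<forall>A. projection_from P A \<longrightarrow>
         complete_intersection 6 10 (proj_image A klein_configuration)))"
proof -
  \<comment> \<open>The conditions on a centre \<open>p\<close> are that
    \<open>line_form j p\<close> and \<open>point_form k i p\<close> do not vanish at certain
    points; skew symmetry makes each a linear condition on \<open>p\<close>.\<close>
  define S where "S =
    (\<lambda>(j, k, i). line_form j (klein_point k i)) ` {(j, k, i). j < 10 \<and> k < 10 \<and> i < 6 \<and> j \<noteq> k} \<union>
    (\<lambda>(k, i, j). point_form k i (klein_point k j)) ` {(k, i, j). k < 10 \<and> i < 6 \<and> j < 6 \<and> i \<noteq> j}"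
  have "finite {(j, k, i). j < (10::nat) \<and> k < (10::nat) \<and> i < (6::nat) \<and> j \<noteq> k}"
    by (rule finite_subset[of _ "{..<10} \<times> {..<10} \<times> {..<6}"]) auto
  moreover have "finite {(k, i, j). k < (10::nat) \<and> i < (6::nat) \<and> j < (6::nat) \<and> i \<noteq> j}"
    by (rule finite_subset[of _ "{..<10} \<times> {..<6} \<times> {..<6}"]) auto
  ultimately have "finite S"
    unfolding S_def by blast
  moreover have "base_point $ 1 = 1"
    by (simp add: base_point_def)
  then have "base_point \<noteq> 0"
    by (metis zero_index zero_neq_one)
  moreover have "dot u base_point \<noteq> 0" if "u \<in> S" for u
    using that line_form_base_point point_form_base_point unfolding S_def by auto
  moreover have "vec.span {p} \<notin> klein_configuration \<and>
      (\<forall>A. projection_from (vec.span {p}) A \<longrightarrow> complete_intersection 6 10 (proj_image A klein_configuration))"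
    if "p \<noteq> 0" and p: "\<And>u. u \<in> S \<Longrightarrow> dot u p \<noteq> 0" for p
  proof -
    have line: "dot (line_form j p) (klein_point k i) \<noteq> 0" if "j < 10" "k < 10" "i < 6" "j \<noteq> k" for j k i
      using p[of "line_form j (klein_point k i)"] that line_form_skew[of j p] by (force simp: S_def)
    have point: "dot (point_form k i p) (klein_point k j) \<noteq> 0" if "k < 10" "i < 6" "j < 6" "i \<noteq> j" for k i j
      using p[of "point_form k i (klein_point k j)"] that point_form_skew[of k i p] by (force simp: S_def)
    \<comment> \<open>If the centre were proportional to a point of row \<open>k\<close>, then
      \<open>line_form j p\<close>, which vanishes at \<open>p\<close>, would vanish at that point
      too.\<close>
    have "vec.span {p} \<noteq> vec.span {klein_point k i}" if "k < 10" "i < 6" for k i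
    proof
      assume "vec.span {p} = vec.span {klein_point k i}"
      then have "klein_point k i \<in> vec.span {p}"
        by (simp add: vec.span_base)
      then obtain c where c: "klein_point k i = c *s p"
        by (auto simp: vec.span_singleton)
      obtain j :: nat where j: "j < 10" "j \<noteq> k"
        using ex_other_index by blast
      have "dot (line_form j p) p = 0"
        using line_form_skew[OF j(1), of p p] by simp
      then show False
        using line[OF j(1) that j(2)] c by simp
    qed
    then show ?thesis
      using klein_projection[OF _ \<open>p \<noteq> 0\<close> line point] by (auto simp: klein_configuration_eq)
  qed
  ultimately have general: "for_general_point (\<lambda>P. P \<notin> klein_configuration \<and>
      (\<forall>A. projection_from P A \<longrightarrow> complete_intersection 6 10 (proj_image A klein_configuration)))"
    by (rule for_general_point_avoiding)
  have "finite klein_configuration"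
    unfolding klein_configuration_eq by (intro finite_imageI) simp
  moreover have "klein_configuration \<subseteq> proj_space"
  proof
    fix P assume "P \<in> klein_configuration"
    then obtain k i where "k < 10" "i < 6" "P = vec.span {klein_point k i}"
      unfolding klein_configuration_eq by force
    then show "P \<in> proj_space"
      unfolding proj_space_def using klein_point_nonzero by blast
  qed
  moreover have "for_general_point (\<lambda>P. P \<notin> klein_configuration \<and>
      (\<forall>A. projection_from P A \<longrightarrow> (\<exists>a b. complete_intersection a b (proj_image A klein_configuration))))"
    by (rule for_general_point_mono[OF general]) metis
  ultimately have "geproci klein_configuration"
    unfolding geproci_def by simp
  then show ?thesis
    using general by blast
qed

end
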